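(* Let $T=(T_1,\dots,T_m)\colon\mathcal X\to\mathbb R^m$ be any set of statistics. Define the $m\times m$ matrix $\mathrm{Cov}^W_\theta[T(x)]$ and the $m\times d$ matrix $\nabla_\theta\mathbb E_{p_\theta}[T(x)]^{\mathsf T}$ by $$\mathrm{Cov}^W_\theta[T(x)]_{ij}=\mathrm{Cov}^W_\theta[T_i,T_j]=\mathbb E_{p_\theta}\big[\nabla_xT_i(x)\cdot\nabla_xT_j(x)\big],\qquad \big(\nabla_\theta\mathbb E_{p_\theta}[T(x)]^{\mathsf T}\big)_{ij}=\frac{\partial}{\partial\theta_j}\mathbb E_{p_\theta}[T_i(x)],$$ and let $\nabla_\theta\mathbb E_{p_\theta}[T(x)]$ denote the transpose of the latter matrix. Then $$\mathrm{Cov}^W_\theta[T(x)]\succeq \nabla_\theta\mathbb E_{p_\theta}[T(x)]^{\mathsf T}\,G_W(\theta)^{-1}\,\nabla_\theta\mathbb E_{p_\theta}[T(x)],$$ where $A\succeq B$ means that $A-B$ is positive semi-definite.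
   Context: $\mathcal X\subset\mathbb R^n$ is a sample space, $\Theta\subset\mathbb R^d$ a parameter space, and $\theta\mapsto p_\theta=p(\cdot;\theta)$ a smoothly parametrized family of probability densities on $\mathcal X$ with respect to Lebesgue measure (a statistical model). $\mathbb E_{p_\theta}$ denotes expectation over $x\sim p_\theta$. The Wasserstein score functions $\Phi^W_i\colon\mathcal X\times\Theta\to\mathbb R$, $i=1,\dots,d$, are defined by $$-\nabla_x\cdot\big(p(x;\theta)\nabla_x\Phi_i^W(x;\theta)\big)=\frac{\partial}{\partial\theta_i}p(x;\theta),\qquad \mathbb E_{p_\theta}\Phi_i^W=0 .$$ The Wasserstein information matrix is the $d\times d$ matrix $G_W(\theta)_{ij}=\mathbb E_{p_\theta}[\nabla_x\Phi_i^W(x;\theta)\cdot\nabla_x\Phi_j^W(x;\theta)]$. For real-valued statistics $T_1,T_2$ (functions of $x$), the Wasserstein covariance is $\mathrm{Cov}^W_\theta[T_1,T_2]=\mathbb E_{p_\theta}[\nabla_xT_1(x)\cdot\nabla_xT_2(x)]$. Standing conventions: the densities satisfy suitable regularity conditions so that each $\Phi_i^W$ exists and is unique; $G_W(\theta)$ is invertible; statistics are smooth with the expectations involved finite; differentiation in $\theta$ may be interchanged with integration over $\mathcal X$; and integration by parts in $x$ produces no boundary terms. *)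

theory Defs
  imports "HOL-Analysis.Analysis" "HOL-Probability.Probability"
begin

subsection \<open>Differential operators on coordinate space\<close>

definition partial_deriv :: "'k::finite \<Rightarrow> (real ^ 'k \<Rightarrow> real) \<Rightarrow> real ^ 'k \<Rightarrow> real" where
  "partial_deriv i f x = deriv (\<lambda>t. f (x + t *\<^sub>R axis i 1)) 0"

definition gradient :: "(real ^ 'k::finite \<Rightarrow> real) \<Rightarrow> real ^ 'k \<Rightarrow> real ^ 'k" where
  "gradient f x = (\<chi> i. partial_deriv i f x)"

definition divergence :: "(real ^ 'k::finite \<Rightarrow> real ^ 'k) \<Rightarrow> real ^ 'k \<Rightarrow> real" where
  "divergence V x = (\<Sum>i\<in>UNIV. partial_deriv i (\<lambda>y. V y $ i) x)"

primrec iterated_partial ::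
    "'k::finite list \<Rightarrow> (real ^ 'k \<Rightarrow> real) \<Rightarrow> real ^ 'k \<Rightarrow> real" where
  "iterated_partial [] f = f"
| "iterated_partial (i # is) f = partial_deriv i (iterated_partial is f)"

text \<open>
  Smoothness of class C-infinity on a set \<open>S\<close> that need not be open means smoothness on an open
  neighbourhood of \<open>S\<close>, so that derivatives at the points of \<open>S\<close> are ordinary two-sided ones.
  For open \<open>S\<close> this is the usual notion.
\<close>

definition smooth_on :: "(real ^ 'k::finite) set \<Rightarrow> (real ^ 'k \<Rightarrow> real) \<Rightarrow> bool" where
  "smooth_on S f \<longleftrightarrow>
     (\<exists>U. open U \<and> S \<subseteq> U \<and> (\<forall>is. iterated_partial is f differentiable_on U))"

subsection \<open>Positive semi-definite matrices\<close>

definition pos_semidef :: "real ^ 'k ^ 'k::finite \<Rightarrow> bool" where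
  "pos_semidef A \<longleftrightarrow> transpose A = A \<and> (\<forall>v. 0 \<le> v \<bullet> (A *v v))"

definition loewner_ge :: "real ^ 'k ^ 'k::finite \<Rightarrow> real ^ 'k ^ 'k \<Rightarrow> bool" (infix "\<succeq>" 50) where
  "A \<succeq> B \<longleftrightarrow> pos_semidef (A - B)"

subsection \<open>Statistical models\<close>

definition model_measure ::
    "(real ^ 'n::finite) set \<Rightarrow> (real ^ 'n \<Rightarrow> real ^ 'd::finite \<Rightarrow> real) \<Rightarrow> real ^ 'd
      \<Rightarrow> (real ^ 'n) measure" where
  "model_measure X p \<theta> = density (lebesgue_on X) (\<lambda>x. ennreal (p x \<theta>))"

definition statistical_model ::
    "(real ^ 'n::finite) set \<Rightarrow> (real ^ 'd::finite) set \<Rightarrow> (real ^ 'n \<Rightarrow> real ^ 'd \<Rightarrow> real)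
      \<Rightarrow> bool" where
  "statistical_model X \<Theta> p \<longleftrightarrow>
     X \<in> sets lebesgue \<and> open \<Theta> \<and>
     (\<forall>\<theta>\<in>\<Theta>. (\<lambda>x. p x \<theta>) \<in> borel_measurable (lebesgue_on X) \<and>
             (\<forall>x\<in>X. 0 \<le> p x \<theta>) \<and> prob_space (model_measure X p \<theta>)) \<and>
     (\<forall>x\<in>X. smooth_on \<Theta> (p x))"

definition expect ::
    "(real ^ 'n::finite) set \<Rightarrow> (real ^ 'n \<Rightarrow> real ^ 'd::finite \<Rightarrow> real) \<Rightarrow> real ^ 'd
      \<Rightarrow> (real ^ 'n \<Rightarrow> real) \<Rightarrow> real" where
  "expect X p \<theta> f = integral\<^sup>L (model_measure X p \<theta>) f"

subsection \<open>Wasserstein scores, information matrix and covariance\<close>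

text \<open>
  The first two conjuncts under the quantifier over \<open>x\<close> make the differential equation meaningful:
  the library's \<^const>\<open>deriv\<close> is total. Uniqueness of the solution is not imposed, so whatever is
  assumed of a family of scores only through this predicate holds for every family of solutions.
\<close>

definition wasserstein_scores ::
    "(real ^ 'n::finite) set \<Rightarrow> (real ^ 'n \<Rightarrow> real ^ 'd::finite \<Rightarrow> real)
      \<Rightarrow> ('d \<Rightarrow> real ^ 'n \<Rightarrow> real ^ 'd \<Rightarrow> real) \<Rightarrow> real ^ 'd \<Rightarrow> bool" where
  "wasserstein_scores X p \<Phi> \<theta> \<longleftrightarrow>
     (\<forall>i. (\<forall>x\<in>X. (\<lambda>y. \<Phi> i y \<theta>) differentiable (at x) \<and>
                (\<lambda>y. p y \<theta> *\<^sub>R gradient (\<lambda>z. \<Phi> i z \<theta>) y) differentiable (at x) \<and>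
                - divergence (\<lambda>y. p y \<theta> *\<^sub>R gradient (\<lambda>z. \<Phi> i z \<theta>) y) x
                  = partial_deriv i (p x) \<theta>) \<and>
          integrable (model_measure X p \<theta>) (\<lambda>x. \<Phi> i x \<theta>) \<and>
          expect X p \<theta> (\<lambda>x. \<Phi> i x \<theta>) = 0)"

definition wasserstein_information ::
    "(real ^ 'n::finite) set \<Rightarrow> (real ^ 'n \<Rightarrow> real ^ 'd::finite \<Rightarrow> real)
      \<Rightarrow> ('d \<Rightarrow> real ^ 'n \<Rightarrow> real ^ 'd \<Rightarrow> real) \<Rightarrow> real ^ 'd \<Rightarrow> real ^ 'd ^ 'd" where
  "wasserstein_information X p \<Phi> \<theta> =
     (\<chi> i j. expect X p \<theta>
        (\<lambda>x. gradient (\<lambda>y. \<Phi> i y \<theta>) x \<bullet> gradient (\<lambda>y. \<Phi> j y \<theta>) x))"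

definition wasserstein_cov ::
    "(real ^ 'n::finite) set \<Rightarrow> (real ^ 'n \<Rightarrow> real ^ 'd::finite \<Rightarrow> real) \<Rightarrow> real ^ 'd
      \<Rightarrow> (real ^ 'n \<Rightarrow> real) \<Rightarrow> (real ^ 'n \<Rightarrow> real) \<Rightarrow> real" where
  "wasserstein_cov X p \<theta> S T = expect X p \<theta> (\<lambda>x. gradient S x \<bullet> gradient T x)"

definition wasserstein_cov_matrix ::
    "(real ^ 'n::finite) set \<Rightarrow> (real ^ 'n \<Rightarrow> real ^ 'd::finite \<Rightarrow> real) \<Rightarrow> real ^ 'd
      \<Rightarrow> (real ^ 'n \<Rightarrow> real ^ 'm::finite) \<Rightarrow> real ^ 'm ^ 'm" where
  "wasserstein_cov_matrix X p \<theta> T =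
     (\<chi> i j. wasserstein_cov X p \<theta> (\<lambda>x. T x $ i) (\<lambda>x. T x $ j))"

text \<open>
  The matrix with \<open>m\<close> rows and \<open>d\<close> columns whose \<open>(i, j)\<close> entry is the derivative of the mean of
  \<open>T\<^sub>i\<close> in direction \<open>\<theta>\<^sub>j\<close>.
\<close>

definition mean_jacobian ::
    "(real ^ 'n::finite) set \<Rightarrow> (real ^ 'n \<Rightarrow> real ^ 'd::finite \<Rightarrow> real) \<Rightarrow> real ^ 'd
      \<Rightarrow> (real ^ 'n \<Rightarrow> real ^ 'm::finite) \<Rightarrow> real ^ 'd ^ 'm" where
  "mean_jacobian X p \<theta> T =
     (\<chi> i j. partial_deriv j (\<lambda>\<eta>. expect X p \<eta> (\<lambda>x. T x $ i)) \<theta>)"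

subsection \<open>Regularity conventions\<close>

definition diff_under_integral ::
    "(real ^ 'n::finite) set \<Rightarrow> (real ^ 'n \<Rightarrow> real ^ 'd::finite \<Rightarrow> real) \<Rightarrow> real ^ 'd
      \<Rightarrow> (real ^ 'n \<Rightarrow> real) \<Rightarrow> bool" where
  "diff_under_integral X p \<theta> f \<longleftrightarrow>
     (\<forall>j. integrable (lebesgue_on X) (\<lambda>x. f x * partial_deriv j (p x) \<theta>) \<and>
          ((\<lambda>t. expect X p (\<theta> + t *\<^sub>R axis j 1) f) has_real_derivative
             integral\<^sup>L (lebesgue_on X) (\<lambda>x. f x * partial_deriv j (p x) \<theta>)) (at 0))"

text \<open>
  By the divergence theorem, the boundary term of an integration by parts of \<open>f\<close> against the vector
  field \<open>V\<close> is the total integral of the divergence of \<open>f V\<close>.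
\<close>

definition no_boundary_term ::
    "(real ^ 'n::finite) set \<Rightarrow> (real ^ 'n \<Rightarrow> real) \<Rightarrow> (real ^ 'n \<Rightarrow> real ^ 'n) \<Rightarrow> bool" where
  "no_boundary_term X f V \<longleftrightarrow>
     integral\<^sup>L (lebesgue_on X) (divergence (\<lambda>y. f y *\<^sub>R V y)) = 0"

end

theory Submission
  imports Defs
begin

text \<open>
  Integrating by parts, the score equation turns the derivative of the mean of \<open>T\<^sub>i\<close> in direction
  \<open>\<theta>\<^sub>j\<close> into the expectation of \<open>\<nabla>T\<^sub>i \<bullet> \<nabla>\<Phi>\<^sub>j\<close>. The three matrices in the inequality are therefore the
  blocks of the Gram matrix of the vector fields \<open>\<nabla>T\<^sub>i\<close> and \<open>\<nabla>\<Phi>\<^sub>j\<close>, and the claim says that the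
  Schur complement of a positive semi-definite matrix is positive semi-definite.
\<close>

section \<open>Matrix inverses and Schur complements\<close>

lemma matrix_inv_inverse:
  fixes G :: "'a::semiring_1 ^ 'n ^ 'm"
  assumes "invertible G"
  shows "G ** matrix_inv G = mat 1" "matrix_inv G ** G = mat 1"
  using someI_ex [OF assms [unfolded invertible_def]] unfolding matrix_inv_def by auto

text \<open>Transposing \<open>G ** matrix_inv G = mat 1\<close> turns the transposed inverse into a
  left inverse of \<open>G\<close>, and a left inverse coincides with a right inverse.\<close>

lemma symmetric_matrix_inv:
  fixes G :: "real ^ 'd::finite ^ 'd"
  assumes "invertible G" "transpose G = G"
  shows "transpose (matrix_inv G) = matrix_inv G"
proof -
  let ?H = "matrix_inv G"
  have GH: "G ** ?H = mat 1"
    using assms(1) by (rule matrix_inv_inverse)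
  have "transpose ?H ** G = mat 1"
    using GH by (metis assms(2) matrix_transpose_mul transpose_mat)
  then have "transpose ?H ** G ** ?H = ?H"
    by simp
  then show ?thesis
    using GH by (simp add: matrix_mul_assoc [symmetric])
qed

text \<open>The form in \<open>nonneg\<close> belongs to the symmetric block matrix with blocks
  \<open>A\<close>, \<open>B\<close>, \<open>G\<close>, taken at the pair of \<open>v\<close> and
  \<open>- c\<close>. Its minimum over \<open>c\<close> is the form of the Schur complement at
  \<open>v\<close>.\<close>

lemma schur_complement_pos_semidef:
  fixes A :: "real ^ 'm::finite ^ 'm" and B :: "real ^ 'd::finite ^ 'm" and G :: "real ^ 'd ^ 'd"
  assumes symA: "transpose A = A" and symG: "transpose G = G" and inv: "invertible G"
    and nonneg: "\<And>v c. 0 \<le> v \<bullet> (A *v v) - 2 * (v \<bullet> (B *v c)) + c \<bullet> (G *v c)"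
  shows "A \<succeq> B ** matrix_inv G ** transpose B"
  unfolding loewner_ge_def pos_semidef_def
proof (intro conjI allI)
  let ?S = "B ** matrix_inv G ** transpose B"
  have "transpose ?S = ?S"
    by (simp add: matrix_transpose_mul symmetric_matrix_inv [OF inv symG] matrix_mul_assoc)
  moreover have "transpose (A - ?S) = transpose A - transpose ?S"
    by (simp add: transpose_def vec_eq_iff)
  ultimately show "transpose (A - ?S) = A - ?S"
    using symA by simp
next
  fix v :: "real ^ 'm"
  \<comment> \<open>the minimiser over \<open>c\<close> of the quadratic form\<close>
  define c where "c = matrix_inv G *v (transpose B *v v)"
  \<comment> \<open>The simp rule \<open>transpose_matrix_vector\<close> would turn the transposed
    factor into a \<open>v*\<close> product and block the regrouping of the matrices.\<close>
  have Bc: "B *v c = (B ** matrix_inv G ** transpose B) *v v"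
    by (simp add: c_def matrix_vector_mul_assoc matrix_mul_assoc del: transpose_matrix_vector)
  have "G *v c = transpose B *v v"
    using inv by (simp add: c_def matrix_vector_mul_assoc matrix_inv_inverse del: transpose_matrix_vector)
       (simp add: matrix_mul_assoc matrix_inv_inverse)
  \<comment> \<open>This cancels one of the two copies of the mixed term, leaving
    \<open>v \<bullet> (A *v v) - v \<bullet> (B *v c)\<close>.\<close>
  then have "c \<bullet> (G *v c) = v \<bullet> (B *v c)"
    by (simp add: inner_commute [of c] dot_lmul_matrix)
  with nonneg [of v c] Bc
  show "0 \<le> v \<bullet> ((A - B ** matrix_inv G ** transpose B) *v v)"
    by (simp add: matrix_vector_mult_diff_rdistrib inner_diff_right)
qed

section \<open>Gram matrices of vector fields\<close>

lemma inner_matrix_vector_mult: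
  fixes M :: "real ^ 'd::finite ^ 'm::finite"
  shows "v \<bullet> (M *v c) = (\<Sum>i\<in>UNIV. \<Sum>j\<in>UNIV. v $ i * c $ j * M $ i $ j)"
  by (simp add: inner_vec_def matrix_vector_mult_def sum_distrib_left mult_ac)

lemma inner_sum_sum:
  fixes a :: "'i \<Rightarrow> 'e::real_inner"
  shows "(\<Sum>i\<in>I. v i *\<^sub>R a i) \<bullet> (\<Sum>j\<in>J. c j *\<^sub>R b j) = (\<Sum>i\<in>I. \<Sum>j\<in>J. v i * c j * (a i \<bullet> b j))"
  by (subst inner_sum_left) (simp add: inner_sum_right sum_distrib_left mult_ac)

text \<open>The form of the block matrix is the weighted integral of a squared norm. The weight sits
  in the integrand and not in the measure, so mixed products have to be measurable only after
  multiplication by \<open>w\<close>.\<close>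

lemma gram_schur_complement:
  fixes M :: "'x measure" and w :: "'x \<Rightarrow> real"
    and a :: "'m::finite \<Rightarrow> 'x \<Rightarrow> 'e::real_inner" and b :: "'d::finite \<Rightarrow> 'x \<Rightarrow> 'e"
    and A :: "real ^ 'm ^ 'm" and B :: "real ^ 'd ^ 'm" and G :: "real ^ 'd ^ 'd"
  assumes w: "\<And>x. x \<in> space M \<Longrightarrow> 0 \<le> w x"
    and A: "\<And>i k. has_bochner_integral M (\<lambda>x. w x * (a i x \<bullet> a k x)) (A $ i $ k)"
    and B: "\<And>i j. has_bochner_integral M (\<lambda>x. w x * (a i x \<bullet> b j x)) (B $ i $ j)"
    and G: "\<And>j l. has_bochner_integral M (\<lambda>x. w x * (b j x \<bullet> b l x)) (G $ j $ l)"
    and inv: "invertible G"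
  shows "A \<succeq> B ** matrix_inv G ** transpose B"
proof (rule schur_complement_pos_semidef)
  \<comment> \<open>Both entries are the integral of one function, as the inner product is
    symmetric.\<close>
  have "A $ i $ k = A $ k $ i" for i k
    using has_bochner_integral_eq [OF A [of i k]] A [of k i] by (simp add: inner_commute)
  then show "transpose A = A"
    by (simp add: vec_eq_iff transpose_def)
  have "G $ j $ l = G $ l $ j" for j l
    using has_bochner_integral_eq [OF G [of j l]] G [of l j] by (simp add: inner_commute)
  then show "transpose G = G"
    by (simp add: vec_eq_iff transpose_def)
  show "invertible G" by (rule inv)
next
  fix v :: "real ^ 'm" and c :: "real ^ 'd"
  let ?q = "v \<bullet> (A *v v) - 2 * (v \<bullet> (B *v c)) + c \<bullet> (G *v c)"
  define u where "u x = (\<Sum>i\<in>UNIV. v $ i *\<^sub>R a i x) - (\<Sum>j\<in>UNIV. c $ j *\<^sub>R b j x)" for x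
  have expand: "w x * (u x \<bullet> u x) =
      (\<Sum>i\<in>UNIV. \<Sum>k\<in>UNIV. v $ i * v $ k * (w x * (a i x \<bullet> a k x)))
      - 2 * (\<Sum>i\<in>UNIV. \<Sum>j\<in>UNIV. v $ i * c $ j * (w x * (a i x \<bullet> b j x)))
      + (\<Sum>j\<in>UNIV. \<Sum>l\<in>UNIV. c $ j * c $ l * (w x * (b j x \<bullet> b l x)))" for x
  proof -
    \<comment> \<open>Naming the two sums lets the square be expanded before any double sum
      appears.\<close>
    define s t where "s = (\<Sum>i\<in>UNIV. v $ i *\<^sub>R a i x)" and "t = (\<Sum>j\<in>UNIV. c $ j *\<^sub>R b j x)"
    have "w x * (u x \<bullet> u x) = w x * (s \<bullet> s) - 2 * (w x * (s \<bullet> t)) + w x * (t \<bullet> t)"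
      by (simp add: u_def s_def [symmetric] t_def [symmetric] inner_diff inner_commute algebra_simps)
    then show ?thesis
      by (simp add: s_def t_def inner_sum_sum sum_distrib_left mult_ac)
  qed
  have "has_bochner_integral M (\<lambda>x. w x * (u x \<bullet> u x)) ?q"
    unfolding expand inner_matrix_vector_mult
    by (intro has_bochner_integral_add has_bochner_integral_diff has_bochner_integral_sum
        has_bochner_integral_mult_right A B G)
  moreover have "0 \<le> integral\<^sup>L M (\<lambda>x. w x * (u x \<bullet> u x))"
    by (intro integral_nonneg_AE AE_I2) (simp add: w)
  ultimately show "0 \<le> ?q"
    by (simp add: has_bochner_integral_iff)
qed

section \<open>Coordinate derivatives and the divergence\<close>

lemma partial_deriv_has_derivative:
  assumes "(f has_derivative f') (at x)"
  shows "((\<lambda>t. f (x + t *\<^sub>R axis i 1)) has_real_derivative f' (axis i 1)) (at 0)"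
    and "partial_deriv i f x = f' (axis i 1)"
proof -
  have lin: "linear f'"
    using assms by (rule has_derivative_linear)
  have "((\<lambda>t. x + t *\<^sub>R axis i 1) has_derivative (\<lambda>t. t *\<^sub>R axis i 1)) (at 0)"
    by (auto intro!: derivative_eq_intros)
  then have "((\<lambda>t. f (x + t *\<^sub>R axis i 1)) has_derivative (\<lambda>t. f' (t *\<^sub>R axis i 1))) (at 0)"
    by (rule has_derivative_compose) (simp add: assms)
  \<comment> \<open>A real derivative is a Frechet derivative of the form "multiply by a constant";
    linearity of \<open>f'\<close> supplies that form.\<close>
  moreover have "(\<lambda>t. f' (t *\<^sub>R axis i 1)) = (*) (f' (axis i 1))"
    by (simp add: linear_scale [OF lin] fun_eq_iff)
  ultimately show D: "((\<lambda>t. f (x + t *\<^sub>R axis i 1)) has_real_derivative f' (axis i 1)) (at 0)"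
    by (simp add: has_field_derivative_def)
  show "partial_deriv i f x = f' (axis i 1)"
    unfolding partial_deriv_def by (rule DERIV_imp_deriv [OF D])
qed

text \<open>The product rule in each coordinate, summed: the pointwise content of integration by
  parts.\<close>

lemma divergence_scaleR:
  fixes f :: "real ^ 'k::finite \<Rightarrow> real" and V :: "real ^ 'k \<Rightarrow> real ^ 'k"
  assumes f: "f differentiable (at x)" and V: "V differentiable (at x)"
  shows "divergence (\<lambda>y. f y *\<^sub>R V y) x = gradient f x \<bullet> V x + f x * divergence V x"
proof -
  obtain f' V' where f': "(f has_derivative f') (at x)" and V': "(V has_derivative V') (at x)"
    using f V unfolding differentiable_def by blast
  have comp: "((\<lambda>y. V y $ i) has_derivative (\<lambda>h. V' h $ i)) (at x)" for i
    using bounded_linear.has_derivative [OF bounded_linear_vec_nth V'] by simp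
  have "((\<lambda>y. (f y *\<^sub>R V y) $ i) has_derivative (\<lambda>h. f x * V' h $ i + f' h * V x $ i)) (at x)" for i
    using has_derivative_mult [OF f' comp [of i]] by simp
  note prod = partial_deriv_has_derivative(2) [OF this]
  show ?thesis
    unfolding divergence_def gradient_def inner_vec_def prod
    by (simp add: partial_deriv_has_derivative(2) [OF f'] partial_deriv_has_derivative(2) [OF comp]
        sum.distrib sum_distrib_left)
qed

lemma smooth_on_imp_differentiable:
  assumes "smooth_on S f" "x \<in> S"
  shows "f differentiable (at x)"
proof -
  obtain U where "open U" "S \<subseteq> U" and D: "\<And>is. iterated_partial is f differentiable_on U"
    using assms(1) unfolding smooth_on_def by blast
  then show ?thesis
    using D [of "[]"] assms(2) by (auto simp: differentiable_on_eq_differentiable_at)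
qed

text \<open>One-element index lists make the first partial derivatives differentiable, hence
  continuous. Measurability of products with the gradient will rest on this.\<close>

lemma smooth_on_imp_continuous_gradient:
  assumes "smooth_on S f"
  shows "continuous_on S (gradient f)"
proof -
  obtain U where "S \<subseteq> U" and D: "\<And>is. iterated_partial is f differentiable_on U"
    using assms unfolding smooth_on_def by blast
  have "continuous_on S (partial_deriv k f)" for k
    using D [of "[k]"] \<open>S \<subseteq> U\<close>
    by (auto intro: continuous_on_subset dest: differentiable_imp_continuous_on)
  then have "continuous_on S (\<lambda>x. \<chi> k. partial_deriv k f x)"
    by (intro continuous_on_vec_lambda)
  then show ?thesis
    by (simp add: gradient_def [abs_def])
qed

section \<open>Integration against the model density\<close>

lemma has_bochner_integral_density_expect:
  assumes model: "statistical_model X \<Theta> p" and param: "\<theta> \<in> \<Theta>"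
    and int: "integrable (model_measure X p \<theta>) f"
  shows "has_bochner_integral (lebesgue_on X) (\<lambda>x. p x \<theta> * f x) (expect X p \<theta> f)"
proof -
  have meas: "(\<lambda>x. p x \<theta>) \<in> borel_measurable (lebesgue_on X)"
    and nonneg: "AE x in lebesgue_on X. 0 \<le> p x \<theta>"
    using model param unfolding statistical_model_def by (auto intro!: AE_I2)
  \<comment> \<open>Passing to a density keeps the sigma-algebra.\<close>
  have f: "f \<in> borel_measurable (lebesgue_on X)"
    using borel_measurable_integrable [OF int] by (simp add: model_measure_def)
  show ?thesis
    using int meas nonneg f
    by (simp add: has_bochner_integral_iff model_measure_def expect_def integrable_density
        integral_density)
qed

text \<open>Expand the squares of \<open>a - b\<close> and \<open>a + b\<close>. The bound dominates
  a mixed product by two integrable squares.\<close>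

lemma abs_inner_le_half_squares:
  fixes a b :: "'a::real_inner"
  shows "\<bar>a \<bullet> b\<bar> \<le> (a \<bullet> a + b \<bullet> b) / 2"
proof -
  have "0 \<le> (a - b) \<bullet> (a - b)" "0 \<le> (a + b) \<bullet> (a + b)"
    by simp_all
  then show ?thesis
    by (simp add: inner_diff inner_add inner_commute [of b a])
qed

text \<open>For the field \<open>V\<close> equal to density times score gradient, the score equation
  gives div(S V) = grad S . V - S dp/d\<theta>_j. The left side integrates to zero by
  \<open>by_parts\<close>, and \<open>interchange\<close> identifies the integral of the last
  term.\<close>

lemma mean_derivative_eq_expected_gradient:
  fixes X :: "(real ^ 'n::finite) set" and \<Theta> :: "(real ^ 'd::finite) set"
    and S :: "real ^ 'n \<Rightarrow> real"
  assumes model: "statistical_model X \<Theta> p" and param: "\<theta> \<in> \<Theta>"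
    and scores: "wasserstein_scores X p \<Phi> \<theta>"
    and fin_score: "integrable (model_measure X p \<theta>)
          (\<lambda>x. gradient (\<lambda>y. \<Phi> j y \<theta>) x \<bullet> gradient (\<lambda>y. \<Phi> j y \<theta>) x)"
    and smooth: "smooth_on X S"
    and fin_stat: "integrable (model_measure X p \<theta>) (\<lambda>x. gradient S x \<bullet> gradient S x)"
    and interchange: "diff_under_integral X p \<theta> S"
    and by_parts: "no_boundary_term X S (\<lambda>x. p x \<theta> *\<^sub>R gradient (\<lambda>y. \<Phi> j y \<theta>) x)"
  shows "has_bochner_integral (lebesgue_on X)
          (\<lambda>x. p x \<theta> * (gradient S x \<bullet> gradient (\<lambda>y. \<Phi> j y \<theta>) x))
          (partial_deriv j (\<lambda>\<eta>. expect X p \<eta> S) \<theta>)"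
proof -
  let ?L = "lebesgue_on X"
  define b where "b = gradient (\<lambda>y. \<Phi> j y \<theta>)"
  define V where "V x = p x \<theta> *\<^sub>R b x" for x
  have X: "X \<in> sets lebesgue" and nonneg: "\<And>x. x \<in> X \<Longrightarrow> 0 \<le> p x \<theta>"
    using model param unfolding statistical_model_def by auto
  have diffV: "V differentiable (at x)" and divV: "- divergence V x = partial_deriv j (p x) \<theta>"
    if "x \<in> X" for x
    using scores that unfolding wasserstein_scores_def V_def b_def by auto

  have "continuous_on X V"
    using diffV by (intro differentiable_imp_continuous_on)
      (auto simp: differentiable_on_def intro: differentiable_at_withinI)
  \<comment> \<open>\<open>b\<close> itself need not be measurable where the density vanishes, but \<open>V\<close> is\<close>
  then have "continuous_on X (\<lambda>x. gradient S x \<bullet> V x)"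
    by (intro continuous_on_inner smooth_on_imp_continuous_gradient smooth)
  then have meas: "(\<lambda>x. gradient S x \<bullet> V x) \<in> borel_measurable ?L"
    using X by (intro continuous_imp_measurable_on_sets_lebesgue)
  \<comment> \<open>The dominating function for the mixed product: its two parts are the weighted
    squares from \<open>fin_stat\<close> and \<open>fin_score\<close>.\<close>
  have "integrable ?L
      (\<lambda>x. (p x \<theta> * (gradient S x \<bullet> gradient S x) + p x \<theta> * (b x \<bullet> b x)) / 2)"
    using has_bochner_integral_density_expect [OF model param fin_stat]
      has_bochner_integral_density_expect [OF model param fin_score]
    unfolding b_def has_bochner_integral_iff by auto
  then have int1: "integrable ?L (\<lambda>x. gradient S x \<bullet> V x)"
  proof (rule Bochner_Integration.integrable_bound [OF _ meas], intro AE_I2)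
    fix x assume "x \<in> space ?L"
    then have p: "0 \<le> p x \<theta>"
      using nonneg by simp
    have "norm (gradient S x \<bullet> V x) = p x \<theta> * \<bar>gradient S x \<bullet> b x\<bar>"
      using p by (simp add: V_def abs_mult)
    also have "\<dots> \<le> p x \<theta> * ((gradient S x \<bullet> gradient S x + b x \<bullet> b x) / 2)"
      using p by (intro mult_left_mono abs_inner_le_half_squares)
    also have "\<dots> \<le> norm ((p x \<theta> * (gradient S x \<bullet> gradient S x) + p x \<theta> * (b x \<bullet> b x)) / 2)"
      by (simp add: algebra_simps add_divide_distrib)
    finally show "norm (gradient S x \<bullet> V x)
        \<le> norm ((p x \<theta> * (gradient S x \<bullet> gradient S x) + p x \<theta> * (b x \<bullet> b x)) / 2)" .
  qed

  let ?r = "\<lambda>x. S x * partial_deriv j (p x) \<theta>"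
  \<comment> \<open>Unfolding \<open>partial_deriv\<close> only at the mean keeps the derivative of
    \<open>p\<close> under the integral folded.\<close>
  have int2: "integrable ?L ?r"
    and der: "partial_deriv j (\<lambda>\<eta>. expect X p \<eta> S) \<theta> = integral\<^sup>L ?L ?r"
    using interchange unfolding diff_under_integral_def partial_deriv_def [of j "\<lambda>\<eta>. expect X p \<eta> S"]
    by (auto intro: DERIV_imp_deriv)
  \<comment> \<open>The minus sign comes from the score equation, which prescribes
    \<open>- divergence V x\<close>.\<close>
  have "divergence (\<lambda>y. S y *\<^sub>R V y) x = gradient S x \<bullet> V x - ?r x" if "x \<in> X" for x
    using divergence_scaleR [OF smooth_on_imp_differentiable [OF smooth that] diffV [OF that]]
    by (simp add: divV [OF that, symmetric])
  then have "integral\<^sup>L ?L (divergence (\<lambda>y. S y *\<^sub>R V y))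
      = integral\<^sup>L ?L (\<lambda>x. gradient S x \<bullet> V x - ?r x)"
    by (intro Bochner_Integration.integral_cong) auto
  moreover have "integral\<^sup>L ?L (divergence (\<lambda>y. S y *\<^sub>R V y)) = 0"
    using by_parts by (simp add: no_boundary_term_def V_def b_def)
  \<comment> \<open>The integral of the difference is split by integrability of both terms.\<close>
  ultimately have "integral\<^sup>L ?L (\<lambda>x. gradient S x \<bullet> V x) = integral\<^sup>L ?L ?r"
    using int1 int2 by simp
  with int1 der show ?thesis
    by (simp add: has_bochner_integral_iff V_def b_def)
qed

theorem mainTheorem1:
  fixes X :: "(real ^ 'n::finite) set"
    and \<Theta> :: "(real ^ 'd::finite) set"
    and p :: "real ^ 'n \<Rightarrow> real ^ 'd \<Rightarrow> real"
    and \<Phi> :: "'d \<Rightarrow> real ^ 'n \<Rightarrow> real ^ 'd \<Rightarrow> real"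
    and T :: "real ^ 'n \<Rightarrow> real ^ 'm::finite"
    and \<theta> :: "real ^ 'd"
  assumes model: "statistical_model X \<Theta> p"
    and param: "\<theta> \<in> \<Theta>"
    and scores: "wasserstein_scores X p \<Phi> \<theta>"
    and finite_information: "\<And>i j. integrable (model_measure X p \<theta>)
          (\<lambda>x. gradient (\<lambda>y. \<Phi> i y \<theta>) x \<bullet> gradient (\<lambda>y. \<Phi> j y \<theta>) x)"
    and invertible_information: "invertible (wasserstein_information X p \<Phi> \<theta>)"
    and smooth_statistic: "\<And>i. smooth_on X (\<lambda>x. T x $ i)"
    and finite_mean: "\<And>i \<eta>. \<eta> \<in> \<Theta> \<Longrightarrow> integrable (model_measure X p \<eta>) (\<lambda>x. T x $ i)"
    and finite_cov: "\<And>i j. integrable (model_measure X p \<theta>)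
          (\<lambda>x. gradient (\<lambda>y. T y $ i) x \<bullet> gradient (\<lambda>y. T y $ j) x)"
    and interchange: "\<And>i. diff_under_integral X p \<theta> (\<lambda>x. T x $ i)"
    and by_parts: "\<And>i j. no_boundary_term X (\<lambda>x. T x $ i)
          (\<lambda>x. p x \<theta> *\<^sub>R gradient (\<lambda>y. \<Phi> j y \<theta>) x)"
  shows "wasserstein_cov_matrix X p \<theta> T \<succeq>
           mean_jacobian X p \<theta> T ** matrix_inv (wasserstein_information X p \<Phi> \<theta>)
             ** transpose (mean_jacobian X p \<theta> T)"
proof (rule gram_schur_complement [where M = "lebesgue_on X" and w = "\<lambda>x. p x \<theta>"
      and a = "\<lambda>i. gradient (\<lambda>y. T y $ i)" and b = "\<lambda>j. gradient (\<lambda>y. \<Phi> j y \<theta>)"])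
  show "0 \<le> p x \<theta>" if "x \<in> space (lebesgue_on X)" for x
    using model param that unfolding statistical_model_def by simp
  show "has_bochner_integral (lebesgue_on X)
      (\<lambda>x. p x \<theta> * (gradient (\<lambda>y. T y $ i) x \<bullet> gradient (\<lambda>y. T y $ k) x))
      (wasserstein_cov_matrix X p \<theta> T $ i $ k)" for i k
    using has_bochner_integral_density_expect [OF model param finite_cov]
    by (simp add: wasserstein_cov_matrix_def wasserstein_cov_def)
  \<comment> \<open>The off-diagonal block is defined through derivatives of means, so here
    integration by parts enters; the diagonal blocks are expectations by definition.\<close>
  show "has_bochner_integral (lebesgue_on X)
      (\<lambda>x. p x \<theta> * (gradient (\<lambda>y. T y $ i) x \<bullet> gradient (\<lambda>y. \<Phi> j y \<theta>) x))
      (mean_jacobian X p \<theta> T $ i $ j)" for i j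
    using mean_derivative_eq_expected_gradient [OF model param scores finite_information
        smooth_statistic finite_cov interchange by_parts]
    by (simp add: mean_jacobian_def)
  show "has_bochner_integral (lebesgue_on X)
      (\<lambda>x. p x \<theta> * (gradient (\<lambda>y. \<Phi> j y \<theta>) x \<bullet> gradient (\<lambda>y. \<Phi> l y \<theta>) x))
      (wasserstein_information X p \<Phi> \<theta> $ j $ l)" for j l
    using has_bochner_integral_density_expect [OF model param finite_information]
    by (simp add: wasserstein_information_def)
  show "invertible (wasserstein_information X p \<Phi> \<theta>)"
    by (rule invertible_information)
qed

end
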